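(* Let $1\le m<\infty$, let $X$ be an $m$-dimensional real Banach space, let $B=(e_i)_{i=1}^m$ be a strictly monotone normalized basis for $X$, and suppose that a greedy algorithm with dictionary $B$ is norm-reducing with constant $\gamma\in(0,1)$. Then, for each initial vector $x\in X$, the algorithm terminates after finitely many steps.
   Context: A basis $(e_i)_{i=1}^m$ of $X$ is normalized if $\|e_i\|=1$ for all $i$. It is strictly monotone if $\|\sum_{i=1}^{i_0}a_ie_i\|\le\|\sum_{i=1}^m a_ie_i\|$ for all $1\le i_0<m$ and all real $(a_i)$, with equality only if $a_i=0$ for $i=i_0+1,\dots,m$. Greedy algorithm with dictionary $B$: it is given by a greedy step which, applied to any nonzero $y\in X$, selects some $\varphi(y)\in B$ (according to some selection procedure, possibly allowing several choices) and then some $\lambda(y)\in\mathbb{R}$ minimizing $\|y-\lambda\varphi(y)\|$ over $\lambda\in\mathbb{R}$. From the initial vector $x$ set $x_0=x$ and, as long as $x_{n-1}\neq 0$, $x_n=x_{n-1}-\lambda(x_{n-1})\varphi(x_{n-1})$. It is norm-reducing with constant $\gamma\in(0,1)$ if every greedy step satisfies $\|y-\lambda(y)\varphi(y)\|\le\gamma\|y\|$ for every nonzero $y\in X$. It terminates after finitely many steps if $x_N=0$ for some $N$. *)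

theory Defs
  imports "HOL-Analysis.Analysis"
begin

definition is_basis :: "nat \<Rightarrow> (nat \<Rightarrow> 'a::real_normed_vector) \<Rightarrow> bool" where
  "is_basis m e \<longleftrightarrow>
     inj_on e {1..m} \<and> independent (e ` {1..m}) \<and> span (e ` {1..m}) = UNIV"

definition normalized_basis :: "nat \<Rightarrow> (nat \<Rightarrow> 'a::real_normed_vector) \<Rightarrow> bool" where
  "normalized_basis m e \<longleftrightarrow> is_basis m e \<and> (\<forall>i\<in>{1..m}. norm (e i) = 1)"

definition strictly_monotone :: "nat \<Rightarrow> (nat \<Rightarrow> 'a::real_normed_vector) \<Rightarrow> bool" where
  "strictly_monotone m e \<longleftrightarrow>
     (\<forall>i0 (a :: nat \<Rightarrow> real). 1 \<le> i0 \<and> i0 < m \<longrightarrow>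
        norm (\<Sum>i=1..i0. a i *\<^sub>R e i) \<le> norm (\<Sum>i=1..m. a i *\<^sub>R e i) \<and>
        (norm (\<Sum>i=1..i0. a i *\<^sub>R e i) = norm (\<Sum>i=1..m. a i *\<^sub>R e i) \<longrightarrow>
           (\<forall>i\<in>{i0+1..m}. a i = 0)))"

text \<open>The greedy step may allow several choices, so it is modelled as a set-valued map: \<open>S y\<close>
  is the set of all admissible pairs \<open>(\<phi>(y), \<lambda>(y))\<close>. It is only constrained at nonzero \<open>y\<close>,
  since the algorithm stops at \<open>0\<close>. A deterministic selection procedure is the case in which
  each \<open>S y\<close> is a singleton.\<close>

definition greedy_algorithm ::
    "'a::real_normed_vector set \<Rightarrow> ('a \<Rightarrow> ('a \<times> real) set) \<Rightarrow> bool" where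
  "greedy_algorithm B S \<longleftrightarrow>
     (\<forall>y. y \<noteq> 0 \<longrightarrow> S y \<noteq> {} \<and>
        (\<forall>(\<phi>, l)\<in>S y. \<phi> \<in> B \<and> (\<forall>t::real. norm (y - l *\<^sub>R \<phi>) \<le> norm (y - t *\<^sub>R \<phi>))))"

definition norm_reducing :: "real \<Rightarrow> ('a::real_normed_vector \<Rightarrow> ('a \<times> real) set) \<Rightarrow> bool" where
  "norm_reducing \<gamma> S \<longleftrightarrow>
     (\<forall>y. y \<noteq> 0 \<longrightarrow> (\<forall>(\<phi>, l)\<in>S y. norm (y - l *\<^sub>R \<phi>) \<le> \<gamma> * norm y))"

text \<open>A run that has reached \<open>0\<close> is padded with zeros, so that every run is a total sequence.\<close>

definition greedy_run ::
    "('a::real_normed_vector \<Rightarrow> ('a \<times> real) set) \<Rightarrow> 'a \<Rightarrow> (nat \<Rightarrow> 'a) \<Rightarrow> bool" where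
  "greedy_run S x X \<longleftrightarrow> X 0 = x \<and>
     (\<forall>n. if X n = 0 then X (Suc n) = 0
          else (\<exists>(\<phi>, l)\<in>S (X n). X (Suc n) = X n - l *\<^sub>R \<phi>))"

text \<open>Termination is required whichever admissible choices are made along the way.\<close>

definition terminates_from :: "('a::real_normed_vector \<Rightarrow> ('a \<times> real) set) \<Rightarrow> 'a \<Rightarrow> bool" where
  "terminates_from S x \<longleftrightarrow> (\<forall>X. greedy_run S x X \<longrightarrow> (\<exists>N. X N = 0))"

end

theory Submission imports Defs begin

text \<open>If the coordinates of \<open>y\<close> beyond the \<open>k\<close>-th vanish, then strict monotonicity shows that no
  norm-reducing step can select \<open>e i\<close> with \<open>k < i\<close>, and that a step selecting \<open>e k\<close> annihilates the
  \<open>k\<close>-th coordinate. Hence, once the coordinates beyond the \<open>k\<close>-th are zero, \<open>e k\<close> is selected at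
  most once more, so the \<open>k\<close>-th coordinate is eventually constant. It is controlled by the norm,
  which decays geometrically along a run, so this constant is \<open>0\<close>. Descending from \<open>m\<close> to \<open>0\<close> kills
  all coordinates in turn.\<close>

locale strictly_monotone_basis =
  fixes m :: nat and e :: "nat \<Rightarrow> 'a::real_normed_vector"
  assumes normalized: "normalized_basis m e"
    and strict_mono: "strictly_monotone m e"
begin

text \<open>Keeps the lower bound of \<open>{1..m}\<close> from being rewritten to
  \<open>Suc 0\<close>.\<close>

declare One_nat_def [simp del]

text \<open>\<open>representation\<close> is indexed by basis vectors; indexing by position gives
  the order that partial sums need.\<close>

definition coord :: "'a \<Rightarrow> nat \<Rightarrow> real" where
  "coord y i = representation (e ` {1..m}) y (e i)"

lemma inj: "inj_on e {1..m}"
  and indep: "independent (e ` {1..m})"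
  and span_eq: "span (e ` {1..m}) = UNIV"
  and norm_basis: "i \<in> {1..m} \<Longrightarrow> norm (e i) = 1"
  using normalized by (auto simp: normalized_basis_def is_basis_def)

lemma sum_coord: "(\<Sum>i=1..m. coord y i *\<^sub>R e i) = y"
proof -
  have "(\<Sum>b\<in>e ` {1..m}. representation (e ` {1..m}) y b *\<^sub>R b) = y"
    by (rule real_vector.sum_representation_eq) (use indep span_eq in auto)
  then show ?thesis
    by (simp add: sum.reindex[OF inj] coord_def)
qed

lemma coord_eq_0: "(\<And>i. i \<in> {1..m} \<Longrightarrow> coord y i = 0) \<Longrightarrow> y = 0"
  using sum_coord[of y] by simp

lemma coord_diff_scaleR:
  assumes "i \<in> {1..m}" "j \<in> {1..m}"
  shows "coord (y - l *\<^sub>R e j) i = coord y i - (if i = j then l else 0)"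
proof -
  have "e i = e j \<longleftrightarrow> i = j"
    using inj assms by (auto dest: inj_onD)
  then show ?thesis
    using assms indep span_eq
    by (simp add: coord_def real_vector.representation_diff real_vector.representation_scale
        real_vector.representation_basis)
qed

lemma norm_partial_sum_le:
  assumes "k \<le> m"
  shows "norm (\<Sum>i=1..k. coord y i *\<^sub>R e i) \<le> norm y"
proof -
  \<comment> \<open>Strict monotonicity speaks only of proper nonempty partial sums; the two extreme
    cases are trivial.\<close>
  consider "k = 0" | "k = m" | "1 \<le> k" "k < m" using assms by linarith
  then show ?thesis
  proof cases
    case 3
    then have "norm (\<Sum>i=1..k. coord y i *\<^sub>R e i) \<le> norm (\<Sum>i=1..m. coord y i *\<^sub>R e i)"
      using strict_mono unfolding strictly_monotone_def by blast
    then show ?thesis by (simp add: sum_coord)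
  qed (simp_all add: sum_coord)
qed

lemma coord_eq_0_if_norm_le:
  assumes "k \<le> m" "norm y \<le> norm (\<Sum>i=1..k. coord y i *\<^sub>R e i)" "i \<in> {k+1..m}"
  shows "coord y i = 0"
proof (cases "k = 0")
  case True
  then have "y = 0" using assms by simp
  then show ?thesis
    by (simp add: coord_def real_vector.representation_zero)
next
  case False
  \<comment> \<open>The assumed inequality reverses monotonicity, so its equality case applies; k <
    m because i lies in \<open>{k+1..m}\<close>.\<close>
  have "norm (\<Sum>i=1..k. coord y i *\<^sub>R e i) = norm (\<Sum>i=1..m. coord y i *\<^sub>R e i)"
    using assms norm_partial_sum_le[of k y] by (simp add: sum_coord)
  then show ?thesis
    using strict_mono[unfolded strictly_monotone_def, rule_format, of k "coord y"] False assms(3)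
    by auto
qed

lemma partial_sum_eq:
  assumes "k \<le> m" "\<And>i. i \<in> {k+1..m} \<Longrightarrow> coord y i = 0"
  shows "(\<Sum>i=1..k. coord y i *\<^sub>R e i) = y"
proof -
  have "(\<Sum>i=1..k. coord y i *\<^sub>R e i) = (\<Sum>i=1..m. coord y i *\<^sub>R e i)"
    by (rule sum.mono_neutral_left) (use assms in auto)
  then show ?thesis by (simp add: sum_coord)
qed

text \<open>The j-th term is the difference of two consecutive partial sums, each of norm at most
  that of y; hence the factor 2.\<close>

lemma abs_coord_le:
  assumes "j \<in> {1..m}"
  shows "\<bar>coord y j\<bar> \<le> 2 * norm y"
proof -
  have "{1..j} = insert j {1..j - 1}" "j \<notin> {1..j - 1}" using assms by auto
  then have "(\<Sum>i=1..j. coord y i *\<^sub>R e i)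
      = coord y j *\<^sub>R e j + (\<Sum>i=1..j - 1. coord y i *\<^sub>R e i)"
    by simp
  then have "norm (coord y j *\<^sub>R e j)
      \<le> norm (\<Sum>i=1..j. coord y i *\<^sub>R e i) + norm (\<Sum>i=1..j - 1. coord y i *\<^sub>R e i)"
    by (metis add_diff_cancel_right' norm_triangle_ineq4)
  moreover have "j \<le> m" "j - 1 \<le> m" using assms by auto
  ultimately show ?thesis
    using norm_partial_sum_le[of j y] norm_partial_sum_le[of "j - 1" y] norm_basis[OF assms]
    by simp
qed

text \<open>A step along \<open>e j\<close> with j > k leaves the first k coordinates alone, so y is
  a partial sum of the new vector and cannot be longer than it.\<close>

lemma reducing_index_le:
  assumes "k \<le> m" "\<And>i. i \<in> {k+1..m} \<Longrightarrow> coord y i = 0" "j \<in> {1..m}"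
    and "norm (y - l *\<^sub>R e j) < norm y"
  shows "j \<le> k"
proof (rule ccontr)
  assume "\<not> j \<le> k"
  then have "(\<Sum>i=1..k. coord (y - l *\<^sub>R e j) i *\<^sub>R e i) = (\<Sum>i=1..k. coord y i *\<^sub>R e i)"
    using assms(1,3) by (intro sum.cong) (auto simp: coord_diff_scaleR)
  then have "(\<Sum>i=1..k. coord (y - l *\<^sub>R e j) i *\<^sub>R e i) = y"
    using partial_sum_eq[OF assms(1,2)] by simp
  then show False
    using norm_partial_sum_le[OF assms(1), of "y - l *\<^sub>R e j"] assms(4) by simp
qed

text \<open>Removing the j-th coordinate of y gives a competitor z for the minimum. Since z is also
  the partial sum up to j - 1 of the minimizer, minimality forces the equality case of
  monotonicity.\<close>

lemma coord_minimizer_eq_0: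
  assumes j: "j \<in> {1..m}"
    and zero: "\<And>i. i \<in> {j+1..m} \<Longrightarrow> coord y i = 0"
    and min: "\<And>t. norm (y - l *\<^sub>R e j) \<le> norm (y - t *\<^sub>R e j)"
  shows "coord (y - l *\<^sub>R e j) j = 0"
proof -
  define z where "z = y - coord y j *\<^sub>R e j"
  have "(\<Sum>i=1..j - 1. coord z i *\<^sub>R e i) = z"
    by (rule partial_sum_eq) (use j zero in \<open>auto simp: z_def coord_diff_scaleR\<close>)
  moreover have "(\<Sum>i=1..j - 1. coord (y - l *\<^sub>R e j) i *\<^sub>R e i) = (\<Sum>i=1..j - 1. coord z i *\<^sub>R e i)"
    by (rule sum.cong) (use j in \<open>auto simp: z_def coord_diff_scaleR\<close>)
  ultimately have "norm (y - l *\<^sub>R e j) \<le> norm (\<Sum>i=1..j - 1. coord (y - l *\<^sub>R e j) i *\<^sub>R e i)"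
    using min by (simp add: z_def)
  then show ?thesis
    by (rule coord_eq_0_if_norm_le[rotated]) (use j in auto)
qed

lemma greedy_run_terminates:
  assumes greedy: "greedy_algorithm (e ` {1..m}) S"
    and \<gamma>: "0 \<le> \<gamma>" "\<gamma> < 1"
    and reducing: "norm_reducing \<gamma> S"
    and run: "greedy_run S x X"
  shows "\<exists>N. X N = 0"
proof (rule ccontr)
  assume "\<nexists>N. X N = 0"
  \<comment> \<open>The padding with zeros never sets in, so each transition is a genuine greedy
    step.\<close>
  then have nonzero: "X n \<noteq> 0" for n by blast
  have "\<exists>j l. j \<in> {1..m} \<and> X (Suc n) = X n - l *\<^sub>R e j \<and> norm (X (Suc n)) \<le> \<gamma> * norm (X n)
      \<and> (\<forall>t. norm (X n - l *\<^sub>R e j) \<le> norm (X n - t *\<^sub>R e j))" for n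
  proof -
    have "\<exists>p\<in>S (X n). X (Suc n) = X n - snd p *\<^sub>R fst p"
      using run by (simp add: greedy_run_def nonzero split_def)
    then obtain \<phi> l where "(\<phi>, l) \<in> S (X n)" "X (Suc n) = X n - l *\<^sub>R \<phi>"
      by force
    then show ?thesis
      using greedy reducing nonzero[of n] unfolding greedy_algorithm_def norm_reducing_def
      by fastforce
  qed
  then obtain J L where J: "\<And>n. J n \<in> {1..m}"
    and X_Suc: "\<And>n. X (Suc n) = X n - L n *\<^sub>R e (J n)"
    and decay: "\<And>n. norm (X (Suc n)) \<le> \<gamma> * norm (X n)"
    and min: "\<And>n t. norm (X n - L n *\<^sub>R e (J n)) \<le> norm (X n - t *\<^sub>R e (J n))"
    by metis
  have less: "norm (X n - L n *\<^sub>R e (J n)) < norm (X n)" for n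
  proof -
    have "\<gamma> * norm (X n) < norm (X n)" using \<gamma> nonzero[of n] by simp
    then show ?thesis using decay[of n] X_Suc[of n] by simp
  qed
  have "norm (X n) \<le> norm (X 0) * \<gamma> ^ n" for n
  proof (induction n)
    case (Suc n)
    then show ?case
      using decay[of n] mult_left_mono[OF Suc \<gamma>(1)] by (simp add: mult.left_commute)
  qed simp
  moreover have "(\<lambda>n. norm (X 0) * \<gamma> ^ n) \<longlonglongrightarrow> 0"
    using \<gamma> by (intro tendsto_mult_right_zero LIMSEQ_power_zero) simp
  ultimately have lim: "(\<lambda>n. norm (X n)) \<longlonglongrightarrow> 0"
    by - (rule tendsto_sandwich[where f = "\<lambda>_. 0" and h = "\<lambda>n. norm (X 0) * \<gamma> ^ n"],
        simp_all)
  \<comment> \<open>Downward induction: nothing is to be shown for k = m, and k = 0 covers all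
    coordinates.\<close>
  have "\<exists>N. \<forall>n\<ge>N. \<forall>i\<in>{k+1..m}. coord (X n) i = 0" if "k \<le> m" for k
    using that
  proof (induction k rule: inc_induct)
    case base
    then show ?case by simp
  next
    case (step k)
    then obtain N where N: "coord (X n) i = 0" if "n \<ge> N" "i \<in> {Suc k + 1..m}" for n i
      by blast
    have k: "Suc k \<in> {1..m}" "Suc k \<le> m" "k \<le> m" using step by auto
    \<comment> \<open>With coordinate \<open>Suc k\<close> also zero, the selected index is at most
      k, so this coordinate is left untouched. One zero at some M \<ge> N therefore
      suffices.\<close>
    have persists: "coord (X (Suc n)) (Suc k) = 0" if "n \<ge> N" "coord (X n) (Suc k) = 0" for n
    proof -
      have "coord (X n) i = 0" if "i \<in> {k+1..m}" for i
        using N[OF \<open>n \<ge> N\<close>, of i] \<open>coord (X n) (Suc k) = 0\<close> that by (cases "i = Suc k") auto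
      then have "J n \<le> k" by (rule reducing_index_le[OF k(3) _ J less])
      then show ?thesis using that k J by (simp add: X_Suc coord_diff_scaleR)
    qed
    have "\<exists>M\<ge>N. coord (X M) (Suc k) = 0"
    proof (rule ccontr)
      assume *: "\<not> ?thesis"
      have J_ne: "Suc k \<noteq> J n" if "n \<ge> N" for n
      proof
        assume "Suc k = J n"
        then have "coord (X (Suc n)) (Suc k) = 0"
          using coord_minimizer_eq_0[OF k(1) N[OF that], of "L n"] min[of n] by (simp add: X_Suc)
        then show False using * that le_SucI by blast
      qed
      have const: "coord (X (Suc n)) (Suc k) = coord (X n) (Suc k)" if "n \<ge> N" for n
        using J_ne[OF that] by (simp add: X_Suc coord_diff_scaleR[OF k(1) J])
      have "coord (X n) (Suc k) = coord (X N) (Suc k)" if "n \<ge> N" for n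
        using that by (induction n rule: dec_induct) (simp_all add: const)
      \<comment> \<open>A fixed number bounded by a null sequence must be 0, contradicting the
        choice of N as a time with nonzero coordinate under \<open>*\<close>.\<close>
      then have "\<forall>\<^sub>F n in sequentially. \<bar>coord (X N) (Suc k)\<bar> \<le> 2 * norm (X n)"
        unfolding eventually_sequentially using abs_coord_le[OF k(1)] by metis
      moreover have "(\<lambda>n. 2 * norm (X n)) \<longlonglongrightarrow> 0"
        using lim by (rule tendsto_mult_right_zero)
      ultimately have "\<bar>coord (X N) (Suc k)\<bar> \<le> 0"
        by - (rule tendsto_lowerbound[OF _ _ trivial_limit_sequentially])
      then show False using * by auto
    qed
    then obtain M where M: "M \<ge> N" "coord (X M) (Suc k) = 0" by blast
    have "coord (X n) (Suc k) = 0" if "n \<ge> M" for n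
      using that by (induction n rule: dec_induct) (use M persists in auto)
    then have "coord (X n) i = 0" if "n \<ge> M" "i \<in> {k+1..m}" for n i
      using that N[of n i] M(1) by (cases "i = Suc k") auto
    then show ?case by blast
  qed
  from this[of 0] obtain N where "\<forall>n\<ge>N. \<forall>i\<in>{1..m}. coord (X n) i = 0" by auto
  then show False using coord_eq_0[of "X N"] nonzero by blast
qed

end

theorem proposition3p2:
  fixes e :: "nat \<Rightarrow> 'a::banach"
    and m :: nat
    and S :: "'a \<Rightarrow> ('a \<times> real) set"
    and \<gamma> :: real
  assumes "1 \<le> m"
    and "dim (UNIV :: 'a set) = m"
    and "normalized_basis m e"
    and "strictly_monotone m e"
    and "greedy_algorithm (e ` {1..m}) S"
    and "0 < \<gamma>" and "\<gamma> < 1"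
    and "norm_reducing \<gamma> S"
  shows "\<forall>x. terminates_from S x"
proof -
  interpret strictly_monotone_basis m e
    using assms by unfold_locales
  show ?thesis
    using greedy_run_terminates assms unfolding terminates_from_def by (metis less_imp_le)
qed

end
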